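(* For all $1\le k\le n$, $$|\{e\in\mathbf{I}_n(101,110):\operatorname{zero}(e)=k\}|=T_{n,k}.$$ In particular, the cardinality of $\mathbf{I}_n(101,110)$ equals the number of indecomposable partitions of $[n+1]=\{1,2,\dots,n+1\}$.
   Context: An inversion sequence of length $n$ is an integer sequence $e=(e_1,\dots,e_n)$ with $0\le e_i\le i-1$ for all $1\le i\le n$. A word $w_1\cdots w_n$ avoids a pattern $P=p_1\cdots p_k$ if there are no $i_1<\cdots<i_k$ such that $w_{i_1}\cdots w_{i_k}$ is order isomorphic to $P$ (equal letters of $P$ corresponding to equal entries). $\mathbf{I}_n(P_1,\dots,P_r)$ denotes the set of inversion sequences of length $n$ avoiding all of $P_1,\dots,P_r$. For $e\in\mathbf{I}_n$, $\operatorname{zero}(e)=|\{i\in[n]:e_i=0\}|$. The triangle $\{T_{n,k}\}_{1\le k\le n}$ is defined by $T_{1,i}=\delta_{1,i}$ and, for $n\ge2$ and $1\le k\le n$, $$T_{n,k}=T_{n-1,k-1}+k\,T_{n-1,k}+\sum_{j=k+1}^{n-1}T_{n-1,j},$$ with $T_{n,k}=0$ whenever $k<1$ or $k>n$. A set partition of $[n]$ is indecomposable if the only nonempty subset of its blocks that partitions an initial segment $\{1,\dots,m\}$ of $[n]$ is the full set of all blocks. *)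

theory Defs
  imports Main "HOL-Library.Sublist" "HOL-Library.Disjoint_Sets"
begin

text \<open>
  List positions start at 0, so the entry \<open>e\<^sub>i\<close> (with \<open>1 \<le> i \<le> n\<close>) is \<open>e ! (i - 1)\<close> and
  the condition \<open>0 \<le> e\<^sub>i \<le> i - 1\<close> reads \<open>e ! i \<le> i\<close> for all \<open>i < n\<close>.
\<close>

definition inversion_sequences :: "nat \<Rightarrow> nat list set" where
  "inversion_sequences n = {e. length e = n \<and> (\<forall>i<n. e ! i \<le> i)}"

definition order_isomorphic :: "nat list \<Rightarrow> nat list \<Rightarrow> bool" where
  "order_isomorphic u p \<longleftrightarrow> length u = length p \<and>
     (\<forall>i<length p. \<forall>j<length p.
        (u ! i < u ! j \<longleftrightarrow> p ! i < p ! j) \<and> (u ! i = u ! j \<longleftrightarrow> p ! i = p ! j))"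

text \<open>
  \<open>subseq\<close> is the library's relation of being a not necessarily contiguous subsequence.
\<close>

definition avoids :: "nat list \<Rightarrow> nat list \<Rightarrow> bool" where
  "avoids w p \<longleftrightarrow> \<not> (\<exists>u. subseq u w \<and> order_isomorphic u p)"

definition avoiding_inversion_sequences :: "nat \<Rightarrow> nat list set \<Rightarrow> nat list set" where
  "avoiding_inversion_sequences n Ps = {e \<in> inversion_sequences n. \<forall>p\<in>Ps. avoids e p}"

definition zero :: "nat list \<Rightarrow> nat" where
  "zero e = card {i. i < length e \<and> e ! i = 0}"

text \<open>
  The row \<open>n = 0\<close> lies outside the triangle and is set to 0.
\<close>

fun T :: "nat \<Rightarrow> nat \<Rightarrow> nat" where
  "T 0 k = 0"
| "T (Suc 0) k = (if k = 1 then 1 else 0)"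
| "T (Suc (Suc n)) k =
     (if 1 \<le> k \<and> k \<le> Suc (Suc n)
      then T (Suc n) (k - 1) + k * T (Suc n) k + (\<Sum>j = k + 1..Suc n. T (Suc n) j)
      else 0)"

definition indecomposable_partition :: "nat \<Rightarrow> nat set set \<Rightarrow> bool" where
  "indecomposable_partition n P \<longleftrightarrow> partition_on {1..n} P \<and>
     (\<forall>Q. Q \<subseteq> P \<and> Q \<noteq> {} \<and> (\<exists>m\<le>n. partition_on {1..m} Q) \<longrightarrow> Q = P)"

end

theory Submission
  imports Defs
begin

text \<open>
  A sequence avoids 101 and 110 exactly when each entry that occurs at least twice is a lower bound
  for everything after its first occurrence (\<open>avoids_iff_repeats_dominated\<close>). Take such an inversion
  sequence of length \<open>n + 1\<close>, delete its leading 0 and decrease every positive entry by 1. The result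
  is an admissible sequence \<open>e\<close> of length \<open>n\<close>, whose zeros are the remaining old zeros and
  the old ones.
  To invert this one must say which zeros of \<open>e\<close> come from ones, and the domination condition leaves
  few choices: no zero at all, any single zero, or the last \<open>m\<close> zeros for some \<open>m \<ge> 2\<close>. If \<open>e\<close> has \<open>j\<close>
  zeros, then \<open>k\<close> zeros arise in one way for \<open>k = j + 1\<close>, in \<open>k\<close> ways for \<open>k = j\<close>, and in one way for
  each \<open>k\<close> with \<open>1 \<le> k < j\<close>. These are the three terms of the recurrence for \<open>T\<close>.

  For indecomposable partitions, insert the elements \<open>1, 2, \<dots>\<close> one after another and mark a block as
  open as long as it is still to receive elements. Indecomposability says that every cut between \<open>j\<close>
  and \<open>j + 1\<close> is crossed by a block, so that some block is open at every moment but the last. Let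
  \<open>W n h\<close> be the number of states on \<open>{1..n}\<close> with \<open>h\<close> open blocks in which all earlier cuts are
  crossed. The new element may be a closed singleton, open a new block, or join one of the
  open blocks, which it may close or leave open; hence, for \<open>n \<ge> 1\<close> and \<open>h \<ge> 0\<close>,
  \<open>W (n + 1) (h + 1) = (h + 2) W n (h + 1) + [h > 0] W n h + (h + 2) W n (h + 2)\<close>.

  The link between the two is the identity \<open>W n (h + 1) = (\<Sum>k. T n k * ((k - 1) choose h))\<close>
  (\<open>card_unfinished_eq_sum_T\<close>): the operator adjoint to one step of the triangle, applied to
  \<open>k \<mapsto> (k - 1) choose h\<close>, yields the combination
  \<open>(h + 2) ((k - 1) choose (h + 1)) + (h + 2) ((k - 1) choose h) + [h > 0] ((k - 1) choose (h - 1))\<close>,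
  so that both sides satisfy the same recurrence. The case \<open>h = 0\<close> is the row sum of \<open>T\<close>, and on the
  other side a state with one open block becomes an indecomposable partition of \<open>{1..n + 1}\<close> in
  exactly one way, by closing that block with \<open>n + 1\<close>.
\<close>

section \<open>The triangle\<close>

lemma T_outside: "k = 0 \<or> n < k \<Longrightarrow> T n k = 0"
  by (induction n k rule: T.induct) auto

lemma T_Suc:
  assumes "1 \<le> n" "1 \<le> k" "k \<le> Suc n"
  shows "T (Suc n) k = T n (k - 1) + k * T n k + (\<Sum>j = k + 1..n. T n j)"
  using assms by (cases n) auto

text \<open>
  One step of the triangle in adjoint form. An entry \<open>T n j\<close> contributes to row \<open>n + 1\<close> once in
  column \<open>j + 1\<close>, \<open>j\<close> times in column \<open>j\<close>, and once in each column \<open>1, \<dots>, j - 1\<close>; so weighted sums over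
  row \<open>n + 1\<close> become weighted sums over row \<open>n\<close> with a transformed weight.
\<close>

lemma sum_T_Suc:
  assumes "1 \<le> n"
  shows "(\<Sum>k = 1..Suc n. T (Suc n) k * g k)
    = (\<Sum>j = 1..n. T n j * (g (Suc j) + j * g j + (\<Sum>i = 1..<j. g i)))"
proof -
  have a: "(\<Sum>k = 1..Suc n. T n (k - 1) * g k) = (\<Sum>j = 1..n. T n j * g (Suc j))"
    using sum.shift_bounds_cl_Suc_ivl[of "\<lambda>k. T n (k - 1) * g k" 0 n]
    by (simp add: sum.atLeast_Suc_atMost T_outside)
  have b: "(\<Sum>k = 1..Suc n. k * T n k * g k) = (\<Sum>j = 1..n. T n j * (j * g j))"
    by (simp add: T_outside mult_ac)
  have "(\<Sum>k = 1..Suc n. (\<Sum>j = k + 1..n. T n j) * g k)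
      = (\<Sum>k = 1..Suc n. \<Sum>j | j \<in> {1..n} \<and> k < j. T n j * g k)"
    unfolding sum_distrib_right by (intro sum.cong) auto
  also have "\<dots> = (\<Sum>j = 1..n. \<Sum>k | k \<in> {1..Suc n} \<and> k < j. T n j * g k)"
    by (rule sum.swap_restrict) auto
  also have "\<dots> = (\<Sum>j = 1..n. T n j * (\<Sum>i = 1..<j. g i))"
    unfolding sum_distrib_left by (intro sum.cong) auto
  finally have c: "(\<Sum>k = 1..Suc n. (\<Sum>j = k + 1..n. T n j) * g k)
      = (\<Sum>j = 1..n. T n j * (\<Sum>i = 1..<j. g i))" .
  have "(\<Sum>k = 1..Suc n. T (Suc n) k * g k)
      = (\<Sum>k = 1..Suc n. T n (k - 1) * g k + k * T n k * g k + (\<Sum>j = k + 1..n. T n j) * g k)"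
    using assms by (intro sum.cong refl) (simp only: T_Suc atLeastAtMost_iff algebra_simps)
  then show ?thesis
    by (simp only: sum.distrib a b c distrib_left)
qed

lemma sum_binomial_pred: "(\<Sum>i = 1..<j. (i - 1) choose h) = (j - 1) choose Suc h"
proof (induction j)
  case (Suc j)
  then show ?case by (cases j) (auto simp: atLeastLessThanSuc)
qed simp

section \<open>Pattern avoidance as a condition on repeated entries\<close>

lemma subseq_Cons_iff_drop:
  "subseq (a # u) w \<longleftrightarrow> (\<exists>i<length w. w ! i = a \<and> subseq u (drop (Suc i) w))"
proof
  assume "subseq (a # u) w"
  then obtain us zs where w: "w = us @ a # zs" "subseq u zs"
    by (auto dest: list_emb_ConsD)
  then show "\<exists>i<length w. w ! i = a \<and> subseq u (drop (Suc i) w)"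
    by (intro exI[of _ "length us"]) auto
next
  assume "\<exists>i<length w. w ! i = a \<and> subseq u (drop (Suc i) w)"
  then obtain i where i: "i < length w" "w ! i = a" "subseq u (drop (Suc i) w)" by blast
  then have "subseq (a # u) (take i w @ a # drop (Suc i) w)"
    by (intro list_emb_append2 subseq_Cons2)
  then show "subseq (a # u) w" using i(1,2) id_take_nth_drop[of i w] by simp
qed

text \<open>
  Each use of \<open>subseq_Cons_iff_drop\<close> gives an offset into the remaining suffix, and the offsets add up
  to absolute positions.
\<close>

lemma subseq_three_iff:
  "subseq [a, b, c] w \<longleftrightarrow>
     (\<exists>i j k. i < j \<and> j < k \<and> k < length w \<and> w ! i = a \<and> w ! j = b \<and> w ! k = c)"
proof
  assume "subseq [a, b, c] w"
  then obtain i where i: "i < length w" "w ! i = a" "subseq [b, c] (drop (Suc i) w)"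
    unfolding subseq_Cons_iff_drop[of a] by blast
  then obtain j where j: "j < length w - Suc i" "w ! (Suc i + j) = b"
    "subseq [c] (drop (Suc j) (drop (Suc i) w))"
    unfolding subseq_Cons_iff_drop[of b] by auto
  then obtain k where "k < length w - Suc i - Suc j" "w ! (Suc i + (Suc j + k)) = c"
    unfolding subseq_Cons_iff_drop[of c] by (auto simp: add_ac)
  with i j show "\<exists>i j k. i < j \<and> j < k \<and> k < length w \<and> w ! i = a \<and> w ! j = b \<and> w ! k = c"
    by (intro exI[of _ i] exI[of _ "Suc i + j"] exI[of _ "Suc i + (Suc j + k)"]) auto
next
  assume "\<exists>i j k. i < j \<and> j < k \<and> k < length w \<and> w ! i = a \<and> w ! j = b \<and> w ! k = c"
  then obtain i j k where ijk: "i < j" "j < k" "k < length w" "w ! i = a" "w ! j = b" "w ! k = c"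
    by blast
  obtain p where p: "j = Suc i + p" using ijk(1) less_iff_Suc_add by auto
  obtain q where q: "k = Suc j + q" using ijk(2) less_iff_Suc_add by auto
  have "subseq [c] (drop (Suc j) w)"
    using ijk unfolding subseq_Cons_iff_drop by (intro exI[of _ q]) (auto simp: q)
  then have "subseq [b, c] (drop (Suc i) w)"
    using ijk unfolding subseq_Cons_iff_drop[of b]
    by (intro exI[of _ p]) (auto simp: p add_ac)
  then show "subseq [a, b, c] w"
    using ijk unfolding subseq_Cons_iff_drop[of a] by (intro exI[of _ i]) auto
qed

definition repeats_dominated :: "nat list \<Rightarrow> bool" where
  "repeats_dominated e \<longleftrightarrow>
     (\<forall>i j k. i < j \<and> j < length e \<and> e ! i = e ! j \<and> i < k \<and> k < length e \<longrightarrow> e ! i \<le> e ! k)"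

lemma order_isomorphic_three_iff:
  "order_isomorphic u [p, q, r] \<longleftrightarrow> (\<exists>a b c. u = [a, b, c] \<and>
     (a < b \<longleftrightarrow> p < q) \<and> (a = b \<longleftrightarrow> p = q) \<and> (b < c \<longleftrightarrow> q < r) \<and> (b = c \<longleftrightarrow> q = r) \<and>
     (a < c \<longleftrightarrow> p < r) \<and> (a = c \<longleftrightarrow> p = r))"
proof
  assume iso: "order_isomorphic u [p, q, r]"
  then have "length u = 3" by (simp add: order_isomorphic_def)
  then obtain a b c where "u = [a, b, c]"
    by (auto simp: numeral_3_eq_3 length_Suc_conv)
  with iso show "\<exists>a b c. u = [a, b, c] \<and>
     (a < b \<longleftrightarrow> p < q) \<and> (a = b \<longleftrightarrow> p = q) \<and> (b < c \<longleftrightarrow> q < r) \<and> (b = c \<longleftrightarrow> q = r) \<and>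
     (a < c \<longleftrightarrow> p < r) \<and> (a = c \<longleftrightarrow> p = r)"
    by (auto simp: order_isomorphic_def All_less_Suc)
next
  assume "\<exists>a b c. u = [a, b, c] \<and>
     (a < b \<longleftrightarrow> p < q) \<and> (a = b \<longleftrightarrow> p = q) \<and> (b < c \<longleftrightarrow> q < r) \<and> (b = c \<longleftrightarrow> q = r) \<and>
     (a < c \<longleftrightarrow> p < r) \<and> (a = c \<longleftrightarrow> p = r)"
  then obtain a b c where u: "u = [a, b, c]" and
    "(a < b \<longleftrightarrow> p < q)" "(a = b \<longleftrightarrow> p = q)" "(b < c \<longleftrightarrow> q < r)" "(b = c \<longleftrightarrow> q = r)"
    "(a < c \<longleftrightarrow> p < r)" "(a = c \<longleftrightarrow> p = r)" by blast
  moreover from this have "(b < a \<longleftrightarrow> q < p)" "(c < b \<longleftrightarrow> r < q)" "(c < a \<longleftrightarrow> r < p)"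
    by linarith+
  ultimately show "order_isomorphic u [p, q, r]"
    by (auto simp: order_isomorphic_def less_Suc_eq)
qed

text \<open>
  For a repeated value at positions \<open>i < j\<close>, the pattern 101 forbids smaller entries between \<open>i\<close> and
  \<open>j\<close>, and 110 forbids smaller entries after \<open>j\<close>. Together they forbid them everywhere after \<open>i\<close>.
\<close>

lemma avoids_iff_repeats_dominated:
  "avoids e [1, 0, 1] \<and> avoids e [1, 1, 0] \<longleftrightarrow> repeats_dominated e"
proof -
  have 101: "avoids e [1, 0, 1] \<longleftrightarrow>
      (\<forall>i j k. i < j \<and> j < k \<and> k < length e \<and> e ! i = e ! k \<longrightarrow> e ! i \<le> e ! j)"
  proof -
    have iso: "order_isomorphic u [1, 0, 1] \<longleftrightarrow> (\<exists>a b. u = [a, b, a] \<and> b < a)" for u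
      unfolding order_isomorphic_three_iff by auto
    have "(\<exists>u. subseq u e \<and> order_isomorphic u [1, 0, 1]) \<longleftrightarrow> (\<exists>a b. b < a \<and> subseq [a, b, a] e)"
      unfolding iso by blast
    also have "\<dots> \<longleftrightarrow>
        (\<exists>i j k. i < j \<and> j < k \<and> k < length e \<and> e ! i = e ! k \<and> e ! j < e ! i)"
    proof
      assume "\<exists>a b. b < a \<and> subseq [a, b, a] e"
      then obtain a b i j k where "b < a" "i < j" "j < k" "k < length e"
        "e ! i = a" "e ! j = b" "e ! k = a"
        unfolding subseq_three_iff by blast
      then show "\<exists>i j k. i < j \<and> j < k \<and> k < length e \<and> e ! i = e ! k \<and> e ! j < e ! i"
        by (intro exI[of _ i] exI[of _ j] exI[of _ k]) simp
    next
      assume "\<exists>i j k. i < j \<and> j < k \<and> k < length e \<and> e ! i = e ! k \<and> e ! j < e ! i"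
      then show "\<exists>a b. b < a \<and> subseq [a, b, a] e"
        unfolding subseq_three_iff by metis
    qed
    finally show ?thesis unfolding avoids_def by (meson not_less)
  qed
  have 110: "avoids e [1, 1, 0] \<longleftrightarrow>
      (\<forall>i j k. i < j \<and> j < k \<and> k < length e \<and> e ! i = e ! j \<longrightarrow> e ! i \<le> e ! k)"
  proof -
    have iso: "order_isomorphic u [1, 1, 0] \<longleftrightarrow> (\<exists>a b. u = [a, a, b] \<and> b < a)" for u
      unfolding order_isomorphic_three_iff by auto
    have "(\<exists>u. subseq u e \<and> order_isomorphic u [1, 1, 0]) \<longleftrightarrow> (\<exists>a b. b < a \<and> subseq [a, a, b] e)"
      unfolding iso by blast
    also have "\<dots> \<longleftrightarrow>
        (\<exists>i j k. i < j \<and> j < k \<and> k < length e \<and> e ! i = e ! j \<and> e ! k < e ! i)"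
    proof
      assume "\<exists>a b. b < a \<and> subseq [a, a, b] e"
      then obtain a b i j k where "b < a" "i < j" "j < k" "k < length e"
        "e ! i = a" "e ! j = a" "e ! k = b"
        unfolding subseq_three_iff by blast
      then show "\<exists>i j k. i < j \<and> j < k \<and> k < length e \<and> e ! i = e ! j \<and> e ! k < e ! i"
        by (intro exI[of _ i] exI[of _ j] exI[of _ k]) simp
    next
      assume "\<exists>i j k. i < j \<and> j < k \<and> k < length e \<and> e ! i = e ! j \<and> e ! k < e ! i"
      then show "\<exists>a b. b < a \<and> subseq [a, a, b] e"
        unfolding subseq_three_iff by metis
    qed
    finally show ?thesis unfolding avoids_def by (meson not_less)
  qed
  show ?thesis
  proof
    assume av: "avoids e [1, 0, 1] \<and> avoids e [1, 1, 0]"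
    have "e ! i \<le> e ! k" if "i < j" "j < length e" "e ! i = e ! j" "i < k" "k < length e" for i j k
    proof -
      consider "k < j" | "k = j" | "j < k" by linarith
      then show ?thesis using av that unfolding 101 110 by cases auto
    qed
    then show "repeats_dominated e" unfolding repeats_dominated_def by blast
  next
    assume "repeats_dominated e"
    then show "avoids e [1, 0, 1] \<and> avoids e [1, 1, 0]"
      unfolding 101 110 repeats_dominated_def by (meson less_trans)
  qed
qed

definition zeros :: "nat list \<Rightarrow> nat set" where
  "zeros e = {i. i < length e \<and> e ! i = 0}"

lemma finite_zeros [simp]: "finite (zeros e)"
  by (simp add: zeros_def)

lemma zero_eq_card_zeros: "zero e = card (zeros e)"
  by (simp add: zero_def zeros_def)

definition dominated_sequences :: "nat \<Rightarrow> nat list set" where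
  "dominated_sequences n = {e \<in> inversion_sequences n. repeats_dominated e}"

lemma avoiding_eq_dominated_sequences:
  "avoiding_inversion_sequences n {[1, 0, 1], [1, 1, 0]} = dominated_sequences n"
  using avoids_iff_repeats_dominated
  by (auto simp: avoiding_inversion_sequences_def dominated_sequences_def)

lemma finite_dominated_sequences: "finite (dominated_sequences n)"
proof (rule finite_subset)
  show "dominated_sequences n \<subseteq> {e. set e \<subseteq> {..n} \<and> length e = n}"
    by (auto simp: dominated_sequences_def inversion_sequences_def in_set_conv_nth) (meson le_trans less_imp_le)
  show "finite {e. set e \<subseteq> {..n} \<and> length e = n}" by (rule finite_lists_length_eq) simp
qed

text \<open>
  The inverse of deleting the leading 0 and decreasing the positive entries. The positions in \<open>S\<close>,
  meant to be zeros of \<open>e\<close>, become ones and the other zeros stay 0.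
\<close>

definition shift_up :: "nat list \<Rightarrow> nat set \<Rightarrow> nat list" where
  "shift_up e S = 0 # map (\<lambda>i. if e ! i = 0 \<and> i \<notin> S then 0 else Suc (e ! i)) [0..<length e]"

text \<open>
  What domination of repeated ones demands of their positions: once there are two ones, all zeros of
  the smaller sequence behind the first of them must be ones, too.
\<close>

definition ones_choices :: "nat set \<Rightarrow> nat set set" where
  "ones_choices Z = {S. S \<subseteq> Z \<and> (\<forall>i\<in>S. \<forall>j\<in>S. i < j \<longrightarrow> (\<forall>k\<in>Z. i < k \<longrightarrow> k \<in> S))}"

lemma length_shift_up [simp]: "length (shift_up e S) = Suc (length e)"
  by (simp add: shift_up_def)

lemma shift_up_nth_0 [simp]: "shift_up e S ! 0 = 0"
  by (simp add: shift_up_def)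

lemma shift_up_nth_Suc [simp]:
  "i < length e \<Longrightarrow> shift_up e S ! Suc i = (if e ! i = 0 \<and> i \<notin> S then 0 else Suc (e ! i))"
  by (simp add: shift_up_def)

lemma shift_up_in_inversion_sequences_iff:
  "shift_up e S \<in> inversion_sequences (Suc n) \<longleftrightarrow> e \<in> inversion_sequences n"
proof -
  have "(if e ! i = 0 \<and> i \<notin> S then 0 else Suc (e ! i)) \<le> Suc i \<longleftrightarrow> e ! i \<le> i" for i
    by auto
  then show ?thesis by (auto simp: inversion_sequences_def All_less_Suc2)
qed

text \<open>
  Repeated entries above 1 come from repeated positive entries, and the comparisons between them
  and the other entries survive the shift; a repeated 0 imposes nothing. What is new is the condition
  on repeated ones, which can be violated by a zero only.
\<close>

lemma repeats_dominated_shift_up_iff: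
  assumes "S \<subseteq> zeros e"
  shows "repeats_dominated (shift_up e S) \<longleftrightarrow> repeats_dominated e \<and> S \<in> ones_choices (zeros e)"
proof -
  have S: "i < length e \<and> e ! i = 0" if "i \<in> S" for i
    using assms that by (auto simp: zeros_def)
  show ?thesis
  proof (intro iffI conjI)
    assume r: "repeats_dominated (shift_up e S)"
    have R: "shift_up e S ! Suc i \<le> shift_up e S ! Suc k"
      if "i < j" "j < length e" "shift_up e S ! Suc i = shift_up e S ! Suc j" "i < k" "k < length e" for i j k
      using r that unfolding repeats_dominated_def
      by (metis Suc_mono length_shift_up)
    show "repeats_dominated e"
      unfolding repeats_dominated_def
    proof clarify
      fix i j k assume *: "i < j" "j < length e" "e ! i = e ! j" "i < k" "k < length e"
      show "e ! i \<le> e ! k"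
      proof (cases "e ! i = 0")
        case False
        then show ?thesis using R[OF *(1,2) _ *(4,5)] * by (auto split: if_splits)
      qed simp
    qed
    have "k \<in> S" if "i \<in> S" "j \<in> S" "i < j" "k \<in> zeros e" "i < k" for i j k
      using R[of i j k] S[of i] S[of j] that by (auto simp: zeros_def split: if_splits)
    then show "S \<in> ones_choices (zeros e)" using assms unfolding ones_choices_def by blast
  next
    assume *: "repeats_dominated e \<and> S \<in> ones_choices (zeros e)"
    have "shift_up e S ! i \<le> shift_up e S ! k"
      if hyp: "i < j" "j < Suc (length e)" "shift_up e S ! i = shift_up e S ! j" "i < k" "k < Suc (length e)" for i j k
    proof (cases i)
      case (Suc i')
      obtain j' k' where jk: "j = Suc j'" "k = Suc k'"
        using hyp(1,4) by (cases j; cases k) auto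
      have lt: "i' < j'" "j' < length e" "i' < k'" "k' < length e" using hyp by (auto simp: jk Suc)
      have eq: "shift_up e S ! Suc i' = shift_up e S ! Suc j'" using hyp(3) by (simp add: jk Suc)
      consider "e ! i' = 0" "i' \<notin> S" | "i' \<in> S" | "e ! i' \<noteq> 0" by blast
      then show ?thesis
      proof cases
        case 1
        then show ?thesis using lt by (simp add: Suc)
      next
        case 2
        then have "j' \<in> S" using eq lt S[of i'] S[of j'] by (auto split: if_splits)
        then have "k' \<in> S" if "k' \<in> zeros e"
          using * 2 lt that unfolding ones_choices_def by blast
        then show ?thesis using 2 lt S[of i'] by (auto simp: Suc jk zeros_def)
      next
        case 3
        then have "e ! i' = e ! j'" using eq lt S[of j'] by (auto split: if_splits)
        then have "e ! i' \<le> e ! k'" using * lt unfolding repeats_dominated_def by blast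
        then show ?thesis using 3 lt by (auto simp: Suc jk)
      qed
    qed simp
    then show "repeats_dominated (shift_up e S)" unfolding repeats_dominated_def length_shift_up by blast
  qed
qed

lemma zero_shift_up:
  assumes "S \<subseteq> zeros e"
  shows "zero (shift_up e S) = Suc (card (zeros e) - card S)"
proof -
  have "zeros (shift_up e S) = insert 0 (Suc ` (zeros e - S))"
  proof (intro set_eqI)
    fix i show "i \<in> zeros (shift_up e S) \<longleftrightarrow> i \<in> insert 0 (Suc ` (zeros e - S))"
      by (cases i) (auto simp: zeros_def image_iff split: if_splits)
  qed
  then have "zero (shift_up e S) = Suc (card (zeros e - S))"
    by (simp add: zero_eq_card_zeros card_insert_if card_image)
  also have "card (zeros e - S) = card (zeros e) - card S"
    using assms by (simp add: card_Diff_subset finite_subset[OF assms])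
  finally show ?thesis .
qed

lemma inj_on_shift_up: "inj_on (\<lambda>(e, S). shift_up e S) (SIGMA e:UNIV. Pow (zeros e))"
proof (rule inj_onI, clarify)
  fix e S e' S'
  assume S: "S \<subseteq> zeros e" and S': "S' \<subseteq> zeros e'" and eq: "shift_up e S = shift_up e' S'"
  have len: "length e = length e'" using eq by (metis length_shift_up nat.inject)
  have nth: "shift_up e S ! Suc i = shift_up e' S' ! Suc i" for i using eq by simp
  have "e ! i = e' ! i \<and> (i \<in> S \<longleftrightarrow> i \<in> S')" if "i < length e" for i
    using nth[of i] that len S S' by (auto simp: zeros_def split: if_splits)
  moreover have "i < length e" if "i \<in> S \<or> i \<in> S'" for i
    using that S S' len by (auto simp: zeros_def)
  ultimately show "e = e' \<and> S = S'" using len by (auto intro: nth_equalityI)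
qed

text \<open>
  The leading entry of an inversion sequence is 0; the set \<open>S\<close> must be the set of places where the
  tail has a 1, since there the decreased entry no longer reveals it.
\<close>

lemma shift_up_surj:
  assumes "f \<in> inversion_sequences (Suc n)"
  obtains e S where "S \<subseteq> zeros e" "f = shift_up e S"
proof -
  define e where "e = map (\<lambda>x. x - 1) (tl f)"
  define S where "S = {i. i < length e \<and> f ! Suc i = 1}"
  have f: "length f = Suc n" "f ! 0 = 0" using assms by (auto simp: inversion_sequences_def)
  have e: "length e = n" "\<And>i. i < n \<Longrightarrow> e ! i = f ! Suc i - 1"
    using f by (auto simp: e_def nth_tl)
  have "f = shift_up e S"
  proof (rule nth_equalityI)
    fix i assume "i < length f"
    then show "f ! i = shift_up e S ! i" using f e by (cases i) (auto simp: S_def)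
  qed (simp add: f e)
  moreover have "S \<subseteq> zeros e" using e by (auto simp: S_def zeros_def)
  ultimately show ?thesis by (rule that[rotated])
qed

lemma dominated_sequences_Suc:
  "{f \<in> dominated_sequences (Suc n). zero f = k} = (\<lambda>(e, S). shift_up e S) `
     (SIGMA e:dominated_sequences n. {S \<in> ones_choices (zeros e). Suc (card (zeros e) - card S) = k})"
  (is "?L = ?R")
proof
  show "?L \<subseteq> ?R"
  proof
    fix f assume f: "f \<in> ?L"
    then obtain e S where S: "S \<subseteq> zeros e" and eq: "f = shift_up e S"
      using shift_up_surj[of f n] unfolding dominated_sequences_def by blast
    have "(e, S) \<in> (SIGMA e:dominated_sequences n. {S \<in> ones_choices (zeros e). Suc (card (zeros e) - card S) = k})"
      using f repeats_dominated_shift_up_iff[OF S] shift_up_in_inversion_sequences_iff[of e S n] zero_shift_up[OF S]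
      unfolding eq dominated_sequences_def by auto
    then show "f \<in> ?R" unfolding eq by force
  qed
next
  show "?R \<subseteq> ?L"
  proof clarify
    fix e S assume *: "e \<in> dominated_sequences n" "S \<in> ones_choices (zeros e)" "k = Suc (card (zeros e) - card S)"
    then have S: "S \<subseteq> zeros e" by (simp add: ones_choices_def)
    show "shift_up e S \<in> dominated_sequences (Suc n) \<and> zero (shift_up e S) = Suc (card (zeros e) - card S)"
      using * repeats_dominated_shift_up_iff[OF S] shift_up_in_inversion_sequences_iff[of e S n] zero_shift_up[OF S]
      unfolding dominated_sequences_def by auto
  qed
qed

text \<open>
  In a finite chain the upper sets are the sets of the \<open>m\<close> largest elements. For existence, add the
  largest missing element; for uniqueness, any two upper sets are comparable.
\<close>

lemma ex1_upper_set:
  fixes Z :: "nat set"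
  assumes "finite Z" "m \<le> card Z"
  shows "\<exists>!S. S \<subseteq> Z \<and> (\<forall>i\<in>S. \<forall>k\<in>Z. i < k \<longrightarrow> k \<in> S) \<and> card S = m"
proof (rule ex_ex1I)
  show "\<exists>S. S \<subseteq> Z \<and> (\<forall>i\<in>S. \<forall>k\<in>Z. i < k \<longrightarrow> k \<in> S) \<and> card S = m"
    using assms(2)
  proof (induction m)
    case 0
    show ?case by (intro exI[of _ "{}"]) simp
  next
    case (Suc m)
    then obtain S where S: "S \<subseteq> Z" "\<forall>i\<in>S. \<forall>k\<in>Z. i < k \<longrightarrow> k \<in> S" "card S = m" by auto
    then have fin: "finite S" "finite (Z - S)" using assms(1) finite_subset by auto
    have "Z - S \<noteq> {}" using S Suc.prems by auto
    then have M: "Max (Z - S) \<in> Z - S" using fin by (rule_tac Max_in)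
    have "k \<in> insert (Max (Z - S)) S" if "i \<in> insert (Max (Z - S)) S" "k \<in> Z" "i < k" for i k
    proof (cases "i \<in> S")
      case False
      then have "\<not> k \<le> Max (Z - S)" using that by auto
      then have "k \<notin> Z - S" using Max_ge[OF fin(2), of k] by blast
      then show ?thesis using that by auto
    qed (use that S in auto)
    then show ?case using M S fin by (intro exI[of _ "insert (Max (Z - S)) S"]) auto
  qed
next
  fix S S'
  assume S: "S \<subseteq> Z \<and> (\<forall>i\<in>S. \<forall>k\<in>Z. i < k \<longrightarrow> k \<in> S) \<and> card S = m"
    and S': "S' \<subseteq> Z \<and> (\<forall>i\<in>S'. \<forall>k\<in>Z. i < k \<longrightarrow> k \<in> S') \<and> card S' = m"
  have fin: "finite S" "finite S'" using S S' assms(1) finite_subset by blast+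
  have "S \<subseteq> S' \<or> S' \<subseteq> S" 
  proof (rule ccontr)
    assume "\<not> (S \<subseteq> S' \<or> S' \<subseteq> S)"
    then obtain x y where xy: "x \<in> S" "x \<notin> S'" "y \<in> S'" "y \<notin> S" by blast
    then have "x \<noteq> y" by blast
    then consider "x < y" | "y < x" by linarith
    then show False using xy S S' by cases blast+
  qed
  then show "S = S'" using fin S S' by (metis card_subset_eq)
qed

text \<open>
  A singleton is always admissible. For any other cardinality \<open>m\<close>, the admissible sets are the upper
  sets: if \<open>m \<ge> 2\<close>, each element \<open>i\<close> of \<open>S\<close> has a companion \<open>j\<close> in \<open>S\<close>, and the smaller of the two
  forces all later elements of \<open>Z\<close> into \<open>S\<close>; for \<open>m = 0\<close> both notions hold trivially.
\<close>

lemma card_ones_choices: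
  assumes Z: "finite Z"
  shows "card {S \<in> ones_choices Z. card S = m}
    = (if m = 1 then card Z else if m \<le> card Z then 1 else 0)"
proof (cases "m = 1")
  case True
  have "{S \<in> ones_choices Z. card S = m} = (\<lambda>z. {z}) ` Z"
    unfolding True ones_choices_def by (auto simp: card_1_singleton_iff)
  then show ?thesis using True by (simp add: card_image)
next
  case m: False
  have up: "S \<in> ones_choices Z \<longleftrightarrow> S \<subseteq> Z \<and> (\<forall>i\<in>S. \<forall>k\<in>Z. i < k \<longrightarrow> k \<in> S)" if "card S = m" for S
  proof
    assume S: "S \<in> ones_choices Z"
    then have SZ: "S \<subseteq> Z" by (simp add: ones_choices_def)
    have "k \<in> S" if k: "i \<in> S" "k \<in> Z" "i < k" for i k
    proof (rule ccontr)
      assume "k \<notin> S"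
      \<comment> \<open>If \<open>i\<close> has a companion \<open>j\<close>, the smaller of the two lies below \<open>k\<close> and forces \<open>k\<close> into \<open>S\<close>.\<close>
      have "j = i" if j: "j \<in> S" for j
      proof (rule ccontr)
        assume "j \<noteq> i"
        then consider "i < j" | "j < i" by linarith
        then show False
        proof cases
          case 1
          then show False using S k j \<open>k \<notin> S\<close> unfolding ones_choices_def by blast
        next
          case 2
          then have "j < k" using k by simp
          then show False using 2 S k j \<open>k \<notin> S\<close> unfolding ones_choices_def by blast
        qed
      qed
      then have "S = {i}" using k by blast
      then show False using \<open>card S = m\<close> m by simp
    qed
    then show "S \<subseteq> Z \<and> (\<forall>i\<in>S. \<forall>k\<in>Z. i < k \<longrightarrow> k \<in> S)" using SZ by blast
  qed (auto simp: ones_choices_def)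
  have eq: "{S \<in> ones_choices Z. card S = m}
      = {S. S \<subseteq> Z \<and> (\<forall>i\<in>S. \<forall>k\<in>Z. i < k \<longrightarrow> k \<in> S) \<and> card S = m}"
    using up by blast
  show ?thesis
  proof (cases "m \<le> card Z")
    case True
    obtain S where "{S. S \<subseteq> Z \<and> (\<forall>i\<in>S. \<forall>k\<in>Z. i < k \<longrightarrow> k \<in> S) \<and> card S = m} = {S}"
      using ex1_upper_set[OF Z True] by (elim ex1E) blast
    then show ?thesis using True m unfolding eq by simp
  next
    case False
    then have empty: "{S. S \<subseteq> Z \<and> (\<forall>i\<in>S. \<forall>k\<in>Z. i < k \<longrightarrow> k \<in> S) \<and> card S = m} = {}"
      using card_mono[OF Z] by auto
    show ?thesis unfolding eq empty using False m by simp
  qed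
qed

lemma card_ones_choices_zero:
  assumes Z: "finite Z" and k: "1 \<le> k"
  shows "card {S \<in> ones_choices Z. Suc (card Z - card S) = k}
    = (if Suc (card Z) = k then 1 else if card Z = k then k else if k < card Z then 1 else 0)"
proof (cases "k \<le> Suc (card Z)")
  case True
  have "{S \<in> ones_choices Z. Suc (card Z - card S) = k} = {S \<in> ones_choices Z. card S = Suc (card Z) - k}"
    using True k card_mono[OF Z] by (fastforce simp: ones_choices_def)
  then show ?thesis using True k by (simp add: card_ones_choices[OF Z]) auto
next
  case False
  then have eq: "{S \<in> ones_choices Z. Suc (card Z - card S) = k} = {}" by auto
  show ?thesis using False unfolding eq by auto
qed

lemma zero_bounds:
  assumes "e \<in> dominated_sequences n" "1 \<le> n"
  shows "1 \<le> zero e" "zero e \<le> n"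
proof -
  have e: "length e = n" "\<And>i. i < n \<Longrightarrow> e ! i \<le> i"
    using assms by (auto simp: dominated_sequences_def inversion_sequences_def)
  then have "0 \<in> zeros e" using assms e(2)[of 0] by (simp add: zeros_def)
  then show "1 \<le> zero e" unfolding zero_eq_card_zeros
    by (metis One_nat_def Suc_leI card_gt_0_iff empty_iff finite_zeros)
  have "zeros e \<subseteq> {..<n}" using e by (auto simp: zeros_def)
  then show "zero e \<le> n" unfolding zero_eq_card_zeros
    by (metis card_lessThan card_mono finite_lessThan)
qed

text \<open>
  The number of preimages of \<open>e\<close> depends only on its number \<open>j\<close> of zeros, so the sum over all \<open>e\<close> can
  be grouped by \<open>j\<close>.
\<close>

lemma card_dominated_sequences_Suc:
  assumes "1 \<le> n" "1 \<le> k"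
  shows "card {f \<in> dominated_sequences (Suc n). zero f = k}
    = (\<Sum>j = 1..n. card {e \<in> dominated_sequences n. zero e = j} *
        (if Suc j = k then 1 else if j = k then k else if k < j then 1 else 0))"
    (is "_ = (\<Sum>j = 1..n. _ * ?c j)")
proof -
  let ?S = "\<lambda>e. {S \<in> ones_choices (zeros e). Suc (card (zeros e) - card S) = k}"
  have fin: "finite (?S e)" for e
    by (rule finite_subset[of _ "Pow (zeros e)"]) (auto simp: ones_choices_def)
  have inj: "inj_on (\<lambda>(e, S). shift_up e S) (SIGMA e:dominated_sequences n. ?S e)"
    by (rule inj_on_subset[OF inj_on_shift_up]) (auto simp: ones_choices_def)
  have "card {f \<in> dominated_sequences (Suc n). zero f = k} = (\<Sum>e\<in>dominated_sequences n. card (?S e))"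
    unfolding dominated_sequences_Suc card_image[OF inj] by (intro card_SigmaI finite_dominated_sequences ballI fin)
  also have "\<dots> = (\<Sum>e\<in>dominated_sequences n. ?c (zero e))"
    by (intro sum.cong refl) (simp add: card_ones_choices_zero[OF _ assms(2)] zero_eq_card_zeros)
  also have "\<dots> = (\<Sum>j = 1..n. \<Sum>e | e \<in> dominated_sequences n \<and> zero e = j. ?c (zero e))"
    by (rule sum.group[symmetric]) (use finite_dominated_sequences zero_bounds[OF _ assms(1)] in auto)
  also have "\<dots> = (\<Sum>j = 1..n. card {e \<in> dominated_sequences n. zero e = j} * ?c j)"
    by (intro sum.cong refl) simp
  finally show ?thesis .
qed

lemma card_dominated_sequences_zero:
  assumes "1 \<le> n" "1 \<le> k"
  shows "card {e \<in> dominated_sequences n. zero e = k} = T n k"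
  using assms
proof (induction n arbitrary: k rule: dec_induct)
  case base
  have "dominated_sequences 1 = {[0]}"
    by (auto simp: dominated_sequences_def inversion_sequences_def repeats_dominated_def length_Suc_conv)
  moreover have "zero [0] = 1"
  proof -
    have "zeros [0] = {0}" by (auto simp: zeros_def)
    then show ?thesis by (simp add: zero_eq_card_zeros)
  qed
  ultimately have "{e \<in> dominated_sequences 1. zero e = k} = (if k = 1 then {[0]} else {})" by auto
  then show ?case by simp
next
  case (step n)
  have "card {e \<in> dominated_sequences (Suc n). zero e = k} = (\<Sum>j = 1..n. T n j *
        (if Suc j = k then 1 else if j = k then k else if k < j then 1 else 0))"
    unfolding card_dominated_sequences_Suc[OF step(1,4)] by (intro sum.cong refl) (simp add: step.IH)
  also have "\<dots> = (\<Sum>j = 1..n. (if j = k - 1 then T n j else 0) + (if j = k then T n j * k else 0)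
      + (if k < j then T n j else 0))"
    using step(4) by (intro sum.cong refl) auto
  also have "\<dots> = T n (k - 1) + k * T n k + (\<Sum>j = k + 1..n. T n j)"
  proof -
    have "(\<Sum>j = 1..n. if j = k - 1 then T n j else 0) = T n (k - 1)"
      using T_outside[of "k - 1" n] by (auto simp: sum.delta)
    moreover have "(\<Sum>j = 1..n. if j = k then T n j * k else 0) = k * T n k"
      using T_outside[of k n] by (auto simp: sum.delta)
    moreover have "(\<Sum>j = 1..n. if k < j then T n j else 0) = (\<Sum>j = k + 1..n. T n j)"
      by (rule sum.mono_neutral_cong_right) auto
    ultimately show ?thesis by (simp add: sum.distrib)
  qed
  also have "\<dots> = T (Suc n) k"
  proof (cases "k \<le> Suc n")
    case True
    then show ?thesis using T_Suc[OF step(1,4)] by simp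
  next
    case False
    then show ?thesis by (simp add: T_outside)
  qed
  finally show ?case .
qed

section \<open>Partitions with open blocks\<close>

text \<open>
  A state consists of the closed blocks \<open>C\<close> and the open blocks \<open>Q\<close>. An open block counts as crossing
  every cut from its minimum on, because it will receive a later element.
\<close>

definition crossed :: "nat set set \<Rightarrow> nat set set \<Rightarrow> nat \<Rightarrow> bool" where
  "crossed C Q j \<longleftrightarrow>
     (\<exists>B\<in>Q. \<exists>x\<in>B. x \<le> j) \<or> (\<exists>B\<in>C. \<exists>x\<in>B. \<exists>y\<in>B. x \<le> j \<and> j < y)"

text \<open>
  The cut behind the last element \<open>n\<close> is left out, so that the same definition covers complete
  partitions: these are the states with \<open>h = 0\<close>.
\<close>

definition unfinished :: "nat \<Rightarrow> nat \<Rightarrow> (nat set set \<times> nat set set) set" where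
  "unfinished n h = {(C, Q). partition_on {1..n} (C \<union> Q) \<and> C \<inter> Q = {} \<and>
     card Q = h \<and> (\<forall>j\<in>{1..<n}. crossed C Q j)}"

lemma unfinishedD:
  assumes "(C, Q) \<in> unfinished n h"
  shows "partition_on {1..n} (C \<union> Q)" "C \<inter> Q = {}" "card Q = h"
    "\<And>j. 1 \<le> j \<Longrightarrow> j < n \<Longrightarrow> crossed C Q j" "finite C" "finite Q"
  using assms finite_elements[of "{1..n}" "C \<union> Q"] by (auto simp: unfinished_def)

lemma finite_unfinished: "finite (unfinished n h)"
proof (rule finite_subset)
  show "unfinished n h \<subseteq> Pow (Pow {1..n}) \<times> Pow (Pow {1..n})"
    by (auto simp: unfinished_def partition_on_def)
qed simp

lemma partition_on_enlarge_block:
  assumes "partition_on A P" "v \<notin> A" "B \<in> insert {} P"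
  shows "partition_on (insert v A) (insert (insert v B) (P - {B}))"
proof -
  have B: "disjnt B X" if "X \<in> P" "X \<noteq> B" for X
    using assms(1,3) that by (auto simp: partition_on_def disjoint_def disjnt_def)
  have v: "v \<notin> X" if "X \<in> P" for X
    using assms(1,2) that by (auto simp: partition_on_def)
  show ?thesis
  proof (rule partition_onI)
    show "\<Union>(insert (insert v B) (P - {B})) = insert v A"
      using assms(1,3) by (auto simp: partition_on_def)
  next
    fix p q assume "p \<in> insert (insert v B) (P - {B})" "q \<in> insert (insert v B) (P - {B})" "p \<noteq> q"
    moreover have "disjnt (insert v B) X" if "X \<in> P - {B}" for X
      using B[of X] v[of X] that by simp
    moreover have "disjnt X Y" if "X \<in> P" "Y \<in> P" "X \<noteq> Y" for X Y
      using partition_onD2[OF assms(1)] that by (rule pairwiseD)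
    ultimately show "disjnt p q"
      by (elim insertE) (simp_all add: disjnt_sym)
  qed (use partition_onD3[OF assms(1)] in auto)
qed

lemma partition_on_shrink_block:
  assumes "partition_on (insert v A) P" "v \<notin> A" "D \<in> P" "v \<in> D"
  shows "partition_on A ((P - {D}) \<union> ({D - {v}} - {{}}))"
proof (rule partition_onI)
  have dis: "\<And>X Y x. X \<in> P \<Longrightarrow> Y \<in> P \<Longrightarrow> x \<in> X \<Longrightarrow> x \<in> Y \<Longrightarrow> X = Y"
    and un: "\<Union>P = insert v A"
    using assms(1) unfolding partition_on_def disjoint_def by blast+
  have v: "v \<notin> X" if "X \<in> P - {D}" for X
    using dis[of X D v] that assms(3,4) by blast
  show "\<Union>(P - {D} \<union> ({D - {v}} - {{}})) = A"
  proof (intro equalityI subsetI)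
    fix x assume "x \<in> \<Union>(P - {D} \<union> ({D - {v}} - {{}}))"
    then obtain X where "X \<in> P" "x \<in> X" "x \<noteq> v" using v assms(3) by auto
    then show "x \<in> A" using un by auto
  next
    fix x assume "x \<in> A"
    then obtain X where X: "X \<in> P" "x \<in> X" using un by blast
    then show "x \<in> \<Union>(P - {D} \<union> ({D - {v}} - {{}}))"
      using \<open>x \<in> A\<close> assms(2) by (cases "X = D") auto
  qed
  fix p q assume pq: "p \<in> P - {D} \<union> ({D - {v}} - {{}})" "q \<in> P - {D} \<union> ({D - {v}} - {{}})" "p \<noteq> q"
  then obtain p' q' where "p' \<in> P" "q' \<in> P" "p \<subseteq> p'" "q \<subseteq> q'" "p' \<noteq> q'"
    using assms(3) by blast
  then show "disjnt p q" using dis unfolding disjnt_def by blast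
qed (use partition_onD3[OF assms(1)] in auto)

text \<open>
  Allowing \<open>B = {}\<close> in this and the following lemmas treats a new singleton block as the extension of
  an empty open block, which halves the number of cases.
\<close>

lemma crossed_close_block:
  assumes "B \<in> insert {} Q" "j < v"
  shows "crossed (insert (insert v B) C) (Q - {B}) j \<longleftrightarrow> crossed C Q j"
proof
  assume "crossed (insert (insert v B) C) (Q - {B}) j"
  then show "crossed C Q j" using assms unfolding crossed_def by auto
next
  assume "crossed C Q j"
  then show "crossed (insert (insert v B) C) (Q - {B}) j"
  proof (cases "B \<in> Q \<and> (\<exists>x\<in>B. x \<le> j)")
    case True
    then show ?thesis using assms(2) unfolding crossed_def by auto
  next
    case False
    with \<open>crossed C Q j\<close> show ?thesis unfolding crossed_def by blast
  qed
qed

lemma crossed_extend_open_block: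
  assumes "B \<in> insert {} Q" "j < v"
  shows "crossed C (insert (insert v B) (Q - {B})) j \<longleftrightarrow> crossed C Q j"
proof
  assume "crossed C (insert (insert v B) (Q - {B})) j"
  then show "crossed C Q j" using assms unfolding crossed_def by auto
next
  assume "crossed C Q j"
  then show "crossed C (insert (insert v B) (Q - {B})) j"
  proof (cases "B \<in> Q \<and> (\<exists>x\<in>B. x \<le> j)")
    case True
    then show ?thesis unfolding crossed_def by auto
  next
    case False
    with \<open>crossed C Q j\<close> show ?thesis unfolding crossed_def by blast
  qed
qed

text \<open>
  The states on \<open>{1..n}\<close> with a chosen place for the next element, where \<open>h\<close> counts the open blocks
  that remain when the chosen one is set aside. The condition \<open>Q \<noteq> {}\<close> says that the cut behind \<open>n\<close>
  will be crossed.
\<close>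

definition extension_sites :: "nat \<Rightarrow> nat \<Rightarrow> ((nat set set \<times> nat set set) \<times> nat set) set" where
  "extension_sites n h = {((C, Q), B). (C, Q) \<in> unfinished n (card Q) \<and> Q \<noteq> {} \<and>
     B \<in> insert {} Q \<and> card (Q - {B}) = h}"

definition close_with :: "nat \<Rightarrow> (nat set set \<times> nat set set) \<times> nat set \<Rightarrow> nat set set \<times> nat set set" where
  "close_with v = (\<lambda>((C, Q), B). (insert (insert v B) C, Q - {B}))"

definition keep_open_with :: "nat \<Rightarrow> (nat set set \<times> nat set set) \<times> nat set \<Rightarrow> nat set set \<times> nat set set" where
  "keep_open_with v = (\<lambda>((C, Q), B). (C, insert (insert v B) (Q - {B})))"

lemma extension_sitesD:
  assumes "((C, Q), B) \<in> extension_sites n h"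
  shows "(C, Q) \<in> unfinished n (card Q)" "Q \<noteq> {}" "B \<in> insert {} Q" "card (Q - {B}) = h"
    "\<And>X. X \<in> C \<Longrightarrow> Suc n \<notin> X" "\<And>X. X \<in> Q \<Longrightarrow> Suc n \<notin> X" "Suc n \<notin> B"
    "{} \<notin> C" "{} \<notin> Q" "B \<notin> C" "finite Q"
proof -
  show *: "(C, Q) \<in> unfinished n (card Q)" "Q \<noteq> {}" "B \<in> insert {} Q" "card (Q - {B}) = h"
    using assms by (auto simp: extension_sites_def)
  have un: "\<Union>(C \<union> Q) = {1..n}" and ne: "{} \<notin> C \<union> Q"
    using partition_onD1[OF unfinishedD(1)[OF *(1)]] partition_onD3[OF unfinishedD(1)[OF *(1)]]
    by auto
  show "Suc n \<notin> X" if "X \<in> C" for X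
  proof
    assume "Suc n \<in> X"
    then have "Suc n \<in> {1..n}" using that un by blast
    then show False by simp
  qed
  show Q: "Suc n \<notin> X" if "X \<in> Q" for X
  proof
    assume "Suc n \<in> X"
    then have "Suc n \<in> {1..n}" using that un by blast
    then show False by simp
  qed
  show "Suc n \<notin> B" using Q *(3) by auto
  show "{} \<notin> C" "{} \<notin> Q" using ne by auto
  then show "B \<notin> C" using *(3) unfinishedD(2)[OF *(1)] by auto
  show "finite Q" by (rule unfinishedD(6)[OF *(1)])
qed

lemma extension_sites_open_crosses_last:
  assumes "((C, Q), B) \<in> extension_sites n h"
  shows "crossed C Q n"
proof -
  obtain X where "X \<in> Q" using extension_sitesD(2)[OF assms] by blast
  then obtain x where "x \<in> X" using extension_sitesD(9)[OF assms] by (metis equals0I)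
  then have "x \<in> {1..n}" 
    using partition_onD1[OF unfinishedD(1)[OF extension_sitesD(1)[OF assms]]] \<open>X \<in> Q\<close> by blast
  then show ?thesis using \<open>X \<in> Q\<close> \<open>x \<in> X\<close> by (auto simp: crossed_def)
qed

lemma extension_in_unfinished:
  assumes s: "((C, Q), B) \<in> extension_sites n h"
  shows "close_with (Suc n) ((C, Q), B) \<in> unfinished (Suc n) h"
    and "keep_open_with (Suc n) ((C, Q), B) \<in> unfinished (Suc n) (Suc h)"
proof -
  note D = extension_sitesD[OF s] and U = unfinishedD[OF extension_sitesD(1)[OF s]]
  have new: "insert (Suc n) B \<notin> C" "insert (Suc n) B \<notin> Q"
    using D(5,6) by blast+
  have "partition_on (insert (Suc n) {1..n}) (insert (insert (Suc n) B) (C \<union> Q - {B}))"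
    using U(1) D(3) by (intro partition_on_enlarge_block) auto
  moreover have "insert (Suc n) {1..n} = {1..Suc n}" by auto
  moreover have "C \<union> Q - {B} = C \<union> (Q - {B})" using D(10) by auto
  ultimately have part: "partition_on {1..Suc n} (insert (insert (Suc n) B) (C \<union> (Q - {B})))"
    by simp
  have cr: "crossed C Q j" if "1 \<le> j" "j < Suc n" for j
    using U(4)[of j] extension_sites_open_crosses_last[OF s] that by (cases "j = n") auto
  show "close_with (Suc n) ((C, Q), B) \<in> unfinished (Suc n) h"
    using part U(2) D(4) cr new crossed_close_block[OF D(3), of _ "Suc n"]
    by (auto simp: close_with_def unfinished_def)
  show "keep_open_with (Suc n) ((C, Q), B) \<in> unfinished (Suc n) (Suc h)"
    using part U(2) D(4,11) cr new crossed_extend_open_block[OF D(3), of _ "Suc n"]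
    by (auto simp: keep_open_with_def unfinished_def)
qed

text \<open>
  Every state arises from the previous one by undoing the last insertion: remove the largest element
  from its block \<open>D\<close> and regard the rest of \<open>D\<close>, if anything is left, as an open block. The previous
  state has an open block because the cut before the largest element is crossed.
\<close>

lemma unfinished_cases:
  assumes u: "(C', Q') \<in> unfinished (Suc n) h" and n: "1 \<le> n"
  shows "(C', Q') \<in> close_with (Suc n) ` extension_sites n h
    \<or> (\<exists>g. h = Suc g \<and> (C', Q') \<in> keep_open_with (Suc n) ` extension_sites n g)"
proof -
  let ?v = "Suc n"
  note U = unfinishedD[OF u]
  have un: "\<Union>(C' \<union> Q') = {1..Suc n}" and ne: "{} \<notin> C'" "{} \<notin> Q'"
    using partition_onD1[OF U(1)] partition_onD3[OF U(1)] by auto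
  have "?v \<in> \<Union>(C' \<union> Q')" unfolding un by simp
  then obtain D where D: "D \<in> C' \<union> Q'" "?v \<in> D" by blast
  define B where "B = D - {?v}"
  have vB: "?v \<notin> B" and ins: "insert ?v B = D" using D(2) by (auto simp: B_def)
  have "partition_on (insert ?v {1..n}) (C' \<union> Q')"
    using U(1) by (simp add: atLeastAtMostSuc_conv)
  from partition_on_shrink_block[OF this _ D]
  have part: "partition_on {1..n} (C' \<union> Q' - {D} \<union> ({B} - {{}}))" by (simp add: B_def)
  have uniq: "X = D" if "X \<in> C' \<union> Q'" "x \<in> X" "x \<in> D" for X x
    using partition_onD2[OF U(1)] that D(1) unfolding disjoint_def by blast
  have B: "B \<notin> C' \<union> Q'"
  proof
    assume "B \<in> C' \<union> Q'"
    moreover from this have "B \<noteq> {}" using ne by auto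
    ultimately have "B = D" using uniq[of B] ins by blast
    with vB D(2) show False by simp
  qed
  have cross_n: "crossed C' Q' n" using U(4)[of n] n by simp
  show ?thesis
  proof (cases "D \<in> C'")
    case True
    then have DQ: "D \<notin> Q'" using U(2) by blast
    define C Q where "C = C' - {D}" and "Q = Q' \<union> ({B} - {{}})"
    have BQ: "B \<in> insert {} Q" by (auto simp: Q_def)
    have C': "C' = insert (insert ?v B) C" using True by (auto simp: C_def ins)
    have Q': "Q' = Q - {B}" using B by (auto simp: Q_def)
    have "C \<union> Q = C' \<union> Q' - {D} \<union> ({B} - {{}})" using DQ by (auto simp: C_def Q_def)
    then have P: "partition_on {1..n} (C \<union> Q)" using part by simp
    have disj: "C \<inter> Q = {}" using U(2) B by (auto simp: C_def Q_def)
    have cr: "crossed C Q j" if "1 \<le> j" "j \<le> n" for j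
      using U(4)[of j] that crossed_close_block[OF BQ, of j ?v C] unfolding C' Q' by simp
    have "Q \<noteq> {}"
    proof
      assume "Q = {}"
      then have "crossed C {} n" using cr[of n] n by simp
      then obtain X y where X: "X \<in> C" "y \<in> X" "n < y" by (auto simp: crossed_def)
      then have "y \<in> {1..n}" using partition_onD1[OF P] by blast
      with X show False by simp
    qed
    then have "((C, Q), B) \<in> extension_sites n h"
      using P disj cr BQ U(3) Q' by (auto simp: extension_sites_def unfinished_def)
    moreover have "close_with ?v ((C, Q), B) = (C', Q')" by (simp add: close_with_def C' Q')
    ultimately show ?thesis by (metis image_eqI)
  next
    case False
    then have DQ: "D \<in> Q'" using D by blast
    define Q where "Q = Q' - {D} \<union> ({B} - {{}})"
    have BQ: "B \<in> insert {} Q" by (auto simp: Q_def)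
    have QB: "Q - {B} = Q' - {D}" using B by (auto simp: Q_def)
    have Q': "Q' = insert (insert ?v B) (Q - {B})" using DQ by (auto simp: QB ins)
    have "C' \<union> Q = C' \<union> Q' - {D} \<union> ({B} - {{}})" using False by (auto simp: Q_def)
    then have P: "partition_on {1..n} (C' \<union> Q)" using part by simp
    have disj: "C' \<inter> Q = {}" using U(2) B by (auto simp: Q_def)
    have cr: "crossed C' Q j" if "1 \<le> j" "j \<le> n" for j
      using U(4)[of j] that crossed_extend_open_block[OF BQ, of j ?v C'] by (simp flip: Q')
    have "Q \<noteq> {}"
    proof
      assume "Q = {}"
      then have "crossed C' {} n" using cr[of n] n by simp
      then obtain X y where X: "X \<in> C'" "y \<in> X" "n < y" by (auto simp: crossed_def)
      then have "y \<in> {1..n}" using partition_onD1[OF P] by blast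
      with X show False by simp
    qed
    moreover have h: "h = Suc (card (Q - {B}))"
      using U(3,6) DQ by (metis QB card.remove)
    ultimately have "((C', Q), B) \<in> extension_sites n (card (Q - {B}))"
      using P disj cr BQ by (auto simp: extension_sites_def unfinished_def)
    moreover have "keep_open_with ?v ((C', Q), B) = (C', Q')"
      by (simp add: keep_open_with_def flip: Q')
    ultimately show ?thesis using h by (metis image_eqI)
  qed
qed

text \<open>
  The block that contains the new element reveals \<open>B\<close>, and with \<open>B\<close> the previous state.
\<close>

lemma inj_on_close_with: "inj_on (close_with (Suc n)) (extension_sites n h)"
proof (rule inj_onI)
  fix t t' assume t: "t \<in> extension_sites n h" "t' \<in> extension_sites n h"
    "close_with (Suc n) t = close_with (Suc n) t'"
  obtain C Q B where s_eq: "t = ((C, Q), B)" by (metis prod.exhaust)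
  obtain C' Q' B' where s'_eq: "t' = ((C', Q'), B')" by (metis prod.exhaust)
  note s = t(1)[unfolded s_eq] and s' = t(2)[unfolded s'_eq]
  note eq = t(3)[unfolded s_eq s'_eq]
  note D = extension_sitesD[OF s] and D' = extension_sitesD[OF s']
  have eqs: "insert (insert (Suc n) B) C = insert (insert (Suc n) B') C'" "Q - {B} = Q' - {B'}"
    using eq by (auto simp: close_with_def)
  have "insert (Suc n) B = insert (Suc n) B'" using eqs(1) D'(5) by (metis insertE insertI1)
  then have B: "B = B'" using D(7) D'(7) by (metis insert_ident)
  have "insert (Suc n) B \<notin> C" "insert (Suc n) B \<notin> C'" using D(5) D'(5) by blast+
  then have "C = C'" using eqs(1) B by (metis insert_ident)
  moreover have "Q = Q'" using eqs(2) D(3,9) D'(3,9) unfolding B by blast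
  ultimately show "t = t'" using B by (simp add: s_eq s'_eq)
qed

lemma inj_on_keep_open_with: "inj_on (keep_open_with (Suc n)) (extension_sites n h)"
proof (rule inj_onI)
  fix t t' assume t: "t \<in> extension_sites n h" "t' \<in> extension_sites n h"
    "keep_open_with (Suc n) t = keep_open_with (Suc n) t'"
  obtain C Q B where s_eq: "t = ((C, Q), B)" by (metis prod.exhaust)
  obtain C' Q' B' where s'_eq: "t' = ((C', Q'), B')" by (metis prod.exhaust)
  note s = t(1)[unfolded s_eq] and s' = t(2)[unfolded s'_eq]
  note eq = t(3)[unfolded s_eq s'_eq]
  note D = extension_sitesD[OF s] and D' = extension_sitesD[OF s']
  have eqs: "insert (insert (Suc n) B) (Q - {B}) = insert (insert (Suc n) B') (Q' - {B'})" "C = C'"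
    using eq by (auto simp: keep_open_with_def)
  have "insert (Suc n) B = insert (Suc n) B'" using eqs(1) D'(6) by (metis DiffD1 insertE insertI1)
  then have B: "B = B'" using D(7) D'(7) by (metis insert_ident)
  have "insert (Suc n) B \<notin> Q - {B}" "insert (Suc n) B \<notin> Q' - {B}" using D(6) D'(6) by blast+
  then have "Q - {B} = Q' - {B}" using eqs(1) B by (metis insert_ident)
  then have "Q = Q'" using D(3,9) D'(3,9) unfolding B by blast
  then show "t = t'" using B eqs(2) by (simp add: s_eq s'_eq)
qed

text \<open>
  The chosen place is either a fresh block or one of the open blocks, of which there are \<open>h + 1\<close>
  before one is set aside.
\<close>

lemma extension_sites_eq:
  "extension_sites n h = (if h = 0 then {} else unfinished n h) \<times> {{}}
     \<union> (SIGMA (C, Q):unfinished n (Suc h). Q)"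
proof (intro set_eqI, clarify)
  fix C Q :: "nat set set" and B
  have ne: "{} \<notin> Q" "finite Q" if "(C, Q) \<in> unfinished n g" for g
    using partition_onD3[OF unfinishedD(1)[OF that]] unfinishedD(6)[OF that] by auto
  have sz: "card Q = g" if "(C, Q) \<in> unfinished n g" for g
    using unfinishedD(3)[OF that] .
  show "((C, Q), B) \<in> extension_sites n h \<longleftrightarrow>
      ((C, Q), B) \<in> (if h = 0 then {} else unfinished n h) \<times> {{}} \<union> (SIGMA (C, Q):unfinished n (Suc h). Q)"
  proof
    assume "((C, Q), B) \<in> extension_sites n h"
    note D = extension_sitesD[OF this]
    show "((C, Q), B) \<in> (if h = 0 then {} else unfinished n h) \<times> {{}} \<union> (SIGMA (C, Q):unfinished n (Suc h). Q)"
    proof (cases "B = {}")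
      case True
      then have "card Q = h" using D(4,9) by simp
      then show ?thesis using D(1,2,11) True by auto
    next
      case False
      then have "B \<in> Q" using D(3) by simp
      then have "card Q = Suc h" using D(4,11) by (metis card.remove)
      then show ?thesis using D(1) \<open>B \<in> Q\<close> by auto
    qed
  next
    assume "((C, Q), B) \<in> (if h = 0 then {} else unfinished n h) \<times> {{}} \<union> (SIGMA (C, Q):unfinished n (Suc h). Q)"
    then consider "h \<noteq> 0" "(C, Q) \<in> unfinished n h" "B = {}" | "(C, Q) \<in> unfinished n (Suc h)" "B \<in> Q"
      by (auto split: if_splits)
    then show "((C, Q), B) \<in> extension_sites n h"
    proof cases
      case 1
      then show ?thesis using ne[of h] sz[of h] by (auto simp: extension_sites_def)
    next
      case 2
      then show ?thesis using ne[of "Suc h"] sz[of "Suc h"] by (auto simp: extension_sites_def)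
    qed
  qed
qed

lemma finite_extension_sites: "finite (extension_sites n h)"
proof -
  have "finite (SIGMA (C, Q):unfinished n (Suc h). Q)"
    by (rule finite_SigmaI) (auto simp: finite_unfinished dest: unfinishedD(6))
  then show ?thesis by (simp add: extension_sites_eq finite_unfinished)
qed

lemma card_extension_sites:
  "card (extension_sites n h)
     = (if h = 0 then 0 else card (unfinished n h)) + Suc h * card (unfinished n (Suc h))"
proof -
  have "card (SIGMA (C, Q):unfinished n (Suc h). Q) = (\<Sum>(C, Q)\<in>unfinished n (Suc h). card Q)"
    by (subst card_SigmaI) (auto simp: finite_unfinished split_def dest: unfinishedD(6))
  also have "\<dots> = (\<Sum>p\<in>unfinished n (Suc h). Suc h)"
    by (intro sum.cong) (auto dest: unfinishedD(3))
  finally have "card (SIGMA (C, Q):unfinished n (Suc h). Q) = Suc h * card (unfinished n (Suc h))"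
    by simp
  moreover have "card ((if h = 0 then {} else unfinished n h) \<times> {{}})
      = (if h = 0 then 0 else card (unfinished n h))"
    by (simp add: card_cartesian_product)
  moreover have "((if h = 0 then {} else unfinished n h) \<times> {{}})
      \<inter> (SIGMA (C, Q):unfinished n (Suc h). Q) = {}"
    by (auto dest!: unfinishedD(3) split: if_splits)
  moreover have "finite (extension_sites n h)" by (rule finite_extension_sites)
  ultimately show ?thesis
    unfolding extension_sites_eq by (subst card_Un_disjoint) auto
qed

lemma card_unfinished_Suc_0:
  assumes "1 \<le> n"
  shows "card (unfinished (Suc n) 0) = card (unfinished n 1)"
proof -
  have "unfinished (Suc n) 0 = close_with (Suc n) ` extension_sites n 0"
    using extension_in_unfinished(1)[of _ _ _ n 0] unfinished_cases[OF _ assms, of _ _ 0] by fastforce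
  then show ?thesis
    by (simp add: card_image inj_on_close_with card_extension_sites)
qed

text \<open>
  Closed and open extensions cannot coincide, since the block of the new element lies on different
  sides. Leaving the block open puts it back among the open ones, whence the shift in \<open>h\<close>.
\<close>

lemma card_unfinished_Suc_Suc:
  assumes "1 \<le> n"
  shows "card (unfinished (Suc n) (Suc h))
    = card (extension_sites n (Suc h)) + card (extension_sites n h)"
proof -
  let ?A = "close_with (Suc n) ` extension_sites n (Suc h)"
  let ?B = "keep_open_with (Suc n) ` extension_sites n h"
  have "unfinished (Suc n) (Suc h) = ?A \<union> ?B"
    using extension_in_unfinished(1)[of _ _ _ n "Suc h"] extension_in_unfinished(2)[of _ _ _ n h]
      unfinished_cases[OF _ assms, of _ _ "Suc h"] by fastforce
  moreover have "?A \<inter> ?B = {}"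
  proof (rule ccontr)
    assume "?A \<inter> ?B \<noteq> {}"
    then obtain t t' where "t \<in> extension_sites n (Suc h)" "t' \<in> extension_sites n h"
      "close_with (Suc n) t = keep_open_with (Suc n) t'" by blast
    then obtain C Q B C' Q' B' where s: "((C, Q), B) \<in> extension_sites n (Suc h)"
      and s': "((C', Q'), B') \<in> extension_sites n h"
      and eq: "close_with (Suc n) ((C, Q), B) = keep_open_with (Suc n) ((C', Q'), B')"
      by (metis prod.exhaust)
    have "insert (Suc n) B \<in> C'" using eq by (auto simp: close_with_def keep_open_with_def)
    then show False using extension_sitesD(5)[OF s'] by blast
  qed
  ultimately show ?thesis
    by (simp add: card_Un_disjoint finite_extension_sites card_image inj_on_close_with
        inj_on_keep_open_with)
qed

lemma card_unfinished_one:
  "card (unfinished 1 h) = (if h \<le> 1 then 1 else 0)"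
proof -
  have part: "partition_on {1..1::nat} P \<longleftrightarrow> P = {{1}}" for P
  proof
    assume P: "partition_on {1..1::nat} P"
    have "X = {1}" if "X \<in> P" for X
    proof -
      have "X \<subseteq> {1}" using partition_onD1[OF P] that by auto
      moreover have "X \<noteq> {}" using partition_onD3[OF P] that by auto
      ultimately show ?thesis by (simp add: subset_singleton_iff)
    qed
    moreover have "P \<noteq> {}" using partition_onD1[OF P] by auto
    ultimately show "P = {{1}}" by blast
  qed (auto simp: partition_on_def)
  have mem: "(C, Q) \<in> unfinished 1 h \<longleftrightarrow>
      (C = {{1}} \<and> Q = {} \<or> C = {} \<and> Q = {{1}}) \<and> card Q = h" for C Q
  proof -
    have "(C, Q) \<in> unfinished 1 h \<longleftrightarrow> (C \<union> Q = {{1}} \<and> C \<inter> Q = {}) \<and> card Q = h"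
      unfolding unfinished_def mem_Collect_eq case_prod_conv part by simp
    moreover have "C \<union> Q = {{1}} \<and> C \<inter> Q = {} \<longleftrightarrow> C = {{1}} \<and> Q = {} \<or> C = {} \<and> Q = {{1}}"
      by (subst Un_singleton_iff) blast
    ultimately show ?thesis by blast
  qed
  have "unfinished 1 h = {p. (p = ({{1}}, {}) \<or> p = ({}, {{1}})) \<and> card (snd p) = h}"
  proof (rule set_eqI)
    fix p :: "nat set set \<times> nat set set"
    obtain C Q where p: "p = (C, Q)" by (cases p)
    show "p \<in> unfinished 1 h \<longleftrightarrow> p \<in> {p. (p = ({{1}}, {}) \<or> p = ({}, {{1}})) \<and> card (snd p) = h}"
      using mem[of C Q] unfolding p by simp
  qed
  also have "\<dots> = (if h = 0 then {({{1}}, {})} else if h = 1 then {({}, {{1}})} else {})"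
    by auto
  finally show ?thesis by simp
qed

text \<open>
  Induction on \<open>n\<close>. The step rests on a pointwise identity: the transformed weight of
  \<open>sum_T_Suc\<close> for the weight \<open>(j - 1) choose h\<close> is a combination of binomial weights whose
  coefficients are those of the recurrence for the unfinished partitions. The identity follows from
  Pascal's rule and the absorption law for \<open>j * ((j - 1) choose h)\<close>.
\<close>

lemma card_unfinished_eq_sum_T:
  assumes "1 \<le> n"
  shows "card (unfinished n (Suc h)) = (\<Sum>k = 1..n. T n k * ((k - 1) choose h))"
  using assms
proof (induction n arbitrary: h rule: dec_induct)
  case base
  then show ?case by (auto simp: card_unfinished_one[simplified])
next
  case (step n)
  have pt: "(j choose h) + j * ((j - 1) choose h) + ((j - 1) choose Suc h) =
      (h + 2) * ((j - 1) choose h) + (if h = 0 then 0 else (j - 1) choose (h - 1)) + (h + 2) * ((j - 1) choose Suc h)"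
    if j: "1 \<le> j" for j
  proof -
    obtain i where i: "j = Suc i" using j by (cases j) auto
    have "Suc i * (i choose h) = Suc h * (Suc i choose Suc h)"
      by (metis Suc_times_binomial_eq mult.commute)
    then show ?thesis unfolding i by (cases h) (auto simp: algebra_simps)
  qed
  have "(\<Sum>k = 1..Suc n. T (Suc n) k * ((k - 1) choose h))
      = (\<Sum>j = 1..n. T n j * ((j choose h) + j * ((j - 1) choose h) + ((j - 1) choose Suc h)))"
    by (subst sum_T_Suc[OF step(1)]) (simp add: sum_binomial_pred[simplified])
  also have "\<dots> = (\<Sum>j = 1..n. T n j * ((h + 2) * ((j - 1) choose h)
      + (if h = 0 then 0 else (j - 1) choose (h - 1)) + (h + 2) * ((j - 1) choose Suc h)))"
    by (intro sum.cong refl) (simp only: pt atLeastAtMost_iff)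
  also have "\<dots> = (h + 2) * card (unfinished n (Suc h)) + (if h = 0 then 0 else card (unfinished n h))
      + (h + 2) * card (unfinished n (Suc (Suc h)))"
    by (cases h) (simp_all add: step.IH sum.distrib sum_distrib_left algebra_simps)
  also have "\<dots> = card (unfinished (Suc n) (Suc h))"
    by (simp add: card_unfinished_Suc_Suc[OF step(1)] card_extension_sites)
  finally show ?case by simp
qed

text \<open>
  If the cut behind \<open>j < n\<close> is not crossed, the blocks inside \<open>{1..j}\<close> partition \<open>{1..j}\<close> and form a
  proper subset of the blocks. Conversely, a block that crosses the cut behind \<open>m\<close> prevents any set
  of blocks from partitioning \<open>{1..m}\<close>.
\<close>

lemma indecomposable_partition_iff_crossed:
  "indecomposable_partition n P \<longleftrightarrow> partition_on {1..n} P \<and> (\<forall>j\<in>{1..<n}. crossed P {} j)"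
proof (cases "partition_on {1..n} P")
  case part: True
  have un: "\<Union>P = {1..n}" and ne: "{} \<notin> P"
    and uniq: "\<And>X Y x. X \<in> P \<Longrightarrow> Y \<in> P \<Longrightarrow> x \<in> X \<Longrightarrow> x \<in> Y \<Longrightarrow> X = Y"
    using part unfolding partition_on_def disjoint_def by auto
  show ?thesis
  proof
    assume ind: "indecomposable_partition n P"
    have "crossed P {} j" if j: "1 \<le> j" "j < n" for j
    proof (rule ccontr)
      assume nc: "\<not> crossed P {} j"
      define R where "R = {B \<in> P. B \<subseteq> {1..j}}"
      have whole: "B \<subseteq> {1..j}" if "B \<in> P" "x \<in> B" "x \<le> j" for B x
      proof
        fix y assume "y \<in> B"
        then have "y \<in> {1..n}" using un that(1) by blast
        moreover have "y \<le> j" using nc that \<open>y \<in> B\<close> by (force simp: crossed_def)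
        ultimately show "y \<in> {1..j}" by simp
      qed
      have UR: "\<Union>R = {1..j}"
      proof
        show "{1..j} \<subseteq> \<Union>R"
        proof
          fix x assume x: "x \<in> {1..j}"
          then have "x \<in> \<Union>P" unfolding un using j by simp
          then show "x \<in> \<Union>R" using x whole by (auto simp: R_def)
        qed
      qed (auto simp: R_def)
      then have "partition_on {1..j} R"
        using part by (auto simp: partition_on_def R_def disjoint_def)
      moreover have "R \<noteq> {}" using UR j by auto
      moreover have "R \<subseteq> P" by (auto simp: R_def)
      ultimately have "R = P" using ind j unfolding indecomposable_partition_def
        by (meson less_imp_le)
      then show False using UR un j by auto
    qed
    then show "partition_on {1..n} P \<and> (\<forall>j\<in>{1..<n}. crossed P {} j)" using part by simp
  next
    assume *: "partition_on {1..n} P \<and> (\<forall>j\<in>{1..<n}. crossed P {} j)"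
    have "R = P" if R: "R \<subseteq> P" "R \<noteq> {}" "m \<le> n" "partition_on {1..m} R" for R m
    proof -
      have UR: "\<Union>R = {1..m}" and "{} \<notin> R" using R(4) by (auto simp: partition_on_def)
      have "1 \<le> m"
      proof (rule ccontr)
        assume "\<not> 1 \<le> m"
        then have "\<Union>R = {}" using UR by auto
        then show False using R(2) \<open>{} \<notin> R\<close> by auto
      qed
      have "m = n"
      proof (rule ccontr)
        assume "m \<noteq> n"
        then have "crossed P {} m" using * \<open>1 \<le> m\<close> R(3) by auto
        then obtain B x y where B: "B \<in> P" "x \<in> B" "y \<in> B" "x \<le> m" "m < y"
          by (auto simp: crossed_def)
        have "x \<in> {1..n}" using un B by blast
        then have "x \<in> \<Union>R" unfolding UR using B by simp
        then have "B \<in> R" using uniq B R(1) by blast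
        then have "y \<in> {1..m}" using UR B by blast
        then show False using B by simp
      qed
      show "R = P"
      proof
        show "P \<subseteq> R"
        proof
          fix X assume X: "X \<in> P"
          then obtain x where x: "x \<in> X" using ne by (metis equals0I)
          then have "x \<in> \<Union>R" using UR un \<open>m = n\<close> X by blast
          then show "X \<in> R" using uniq X x R(1) by blast
        qed
      qed (rule R)
    qed
    then show "indecomposable_partition n P" using part unfolding indecomposable_partition_def by blast
  qed
qed (simp add: indecomposable_partition_def)

lemma card_indecomposable_partition:
  assumes "1 \<le> n"
  shows "card {P. indecomposable_partition (Suc n) P} = (\<Sum>k = 1..n. T n k)"
proof -
  have "unfinished (Suc n) 0 = (\<lambda>P. (P, {})) ` {P. indecomposable_partition (Suc n) P}"
  proof (intro set_eqI iffI)
    fix p assume "p \<in> unfinished (Suc n) 0"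
    moreover obtain P Q where "p = (P, Q)" by (cases p)
    ultimately have p: "(P, Q) \<in> unfinished (Suc n) 0" and "p = (P, Q)" by auto
    moreover have Q: "Q = {}" using unfinishedD(3,6)[OF p] by simp
    moreover have "indecomposable_partition (Suc n) P"
      using unfinishedD(1,4)[OF p] unfolding Q indecomposable_partition_iff_crossed by simp
    ultimately show "p \<in> (\<lambda>P. (P, {})) ` {P. indecomposable_partition (Suc n) P}" by simp
  qed (auto simp: unfinished_def indecomposable_partition_iff_crossed)
  then have "card {P. indecomposable_partition (Suc n) P} = card (unfinished (Suc n) 0)"
    by (simp add: card_image inj_on_def)
  also have "\<dots> = (\<Sum>k = 1..n. T n k)"
    using card_unfinished_eq_sum_T[OF assms, of 0] by (simp add: card_unfinished_Suc_0[OF assms])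
  finally show ?thesis .
qed

section \<open>The two counts\<close>

theorem theorem7p1:
  fixes n :: nat
  assumes "n \<ge> 1"
  shows "(\<forall>k. 1 \<le> k \<and> k \<le> n \<longrightarrow>
            card {e \<in> avoiding_inversion_sequences n {[1, 0, 1], [1, 1, 0]}. zero e = k} = T n k)
       \<and> card (avoiding_inversion_sequences n {[1, 0, 1], [1, 1, 0]})
         = card {P. indecomposable_partition (n + 1) P}"
proof -
  have "card (dominated_sequences n) = (\<Sum>j = 1..n. \<Sum>e | e \<in> dominated_sequences n \<and> zero e = j. 1)"
    unfolding card_eq_sum
    by (rule sum.group[symmetric]) (use finite_dominated_sequences zero_bounds[OF _ assms] in auto)
  also have "\<dots> = (\<Sum>j = 1..n. T n j)"
    by (intro sum.cong refl) (simp add: card_dominated_sequences_zero[OF assms])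
  also have "\<dots> = card {P. indecomposable_partition (n + 1) P}"
    using card_indecomposable_partition[OF assms] by simp
  finally show ?thesis
    unfolding avoiding_eq_dominated_sequences using card_dominated_sequences_zero[OF assms] by simp
qed

end
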